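(* Let $\mathbb{X}$ be an $n$-dimensional real polyhedral Banach space, and let $\pm v_1,\pm v_2,\ldots,\pm v_m$ be the vertices of $B_{\mathbb{X}}$. For each $i=1,2,\ldots,m$, let $F_{i1},F_{i2},\ldots,F_{in}$ be any $n$ (distinct) facets of $B_{\mathbb{X}}$ meeting at $v_i$, and let $f_{i1},f_{i2},\ldots,f_{in}$ be the $n$ supporting functionals corresponding to the facets $F_{i1},F_{i2},\ldots,F_{in}$ respectively. Let $$\kappa_i=\min_{x\in S_{\mathbb{X}}}\ \max_{1\le r\le n}|f_{ir}(x)|.$$ Then $\kappa_i>0$ for each $i=1,2,\ldots,m$, and the numerical index $n(\mathbb{X})$ of $\mathbb{X}$ satisfies $$n(\mathbb{X})\ \ge\ \min\{\kappa_1,\kappa_2,\ldots,\kappa_m\}.$$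
   Context: All Banach spaces are real. For a Banach space $\mathbb{X}$, $B_{\mathbb{X}}=\{x\in\mathbb{X}:\|x\|\le 1\}$, $S_{\mathbb{X}}=\{x\in\mathbb{X}:\|x\|=1\}$, $\mathbb{X}^*$ is the dual space, and $L(\mathbb{X})$ is the space of bounded linear operators on $\mathbb{X}$ with the operator norm. For $T\in L(\mathbb{X})$ the numerical radius is $v(T)=\sup\{|x^*(Tx)|: x\in S_{\mathbb{X}},\ x^*\in S_{\mathbb{X}^*},\ x^*(x)=1\}$, and the numerical index is $n(\mathbb{X})=\inf\{v(T):T\in L(\mathbb{X}),\ \|T\|=1\}$. A finite-dimensional Banach space $\mathbb{X}$ is polyhedral if $B_{\mathbb{X}}$ has only finitely many extreme points (its vertices); equivalently, $B_{\mathbb{X}}$ is a polyhedron, i.e. a non-empty compact set that is an intersection of finitely many closed half-spaces. The dimension of a polyhedron $P$ is the dimension of the subspace generated by the differences $v-w$ with $v,w\in P$. A polyhedron $Q$ is a face of the polyhedron $P$ if $Q=P$ or $Q=P\cap\delta M$, where $M$ is a closed half-space containing $P$ and $\delta M$ is its boundary. With $n=\dim\mathbb{X}$, a facet of $B_{\mathbb{X}}$ is an $(n-1)$-dimensional face of $B_{\mathbb{X}}$. For a facet $F$ of $B_{\mathbb{X}}$, a functional $f\in S_{\mathbb{X}^*}$ is a supporting functional corresponding to the facet $F$ if (1) $f$ attains its norm at some point $v\in F$ (i.e. $f(v)=\|f\|=1$), and (2) $F=(v+\ker f)\cap S_{\mathbb{X}}$. Each facet has a unique supporting functional. Facets meeting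 at $v_i$ are facets containing $v_i$.
   Formalization: The claim κ_i>0 is made only if n≤3 or f_{i1},…,f_{in} are linearly independent; otherwise it fails: in ℓ_1^4 at e_1 the four functionals (1,1,±1,±1) all vanish at (1/2,−1/2,0,0). The inequality n(X)≥min κ_i is unconditional. *)

theory Defs
  imports "HOL-Analysis.Analysis"
begin

text \<open>
  A Banach space is the type \<open>'a\<close> itself; its dual is \<open>'a \<Rightarrow>\<^sub>L real\<close> and its space of bounded
  operators is \<open>'a \<Rightarrow>\<^sub>L 'a\<close>, both with the operator norm. The library notions \<open>polyhedron\<close>,
  \<open>facet_of\<close> and \<open>aff_dim\<close> live in \<open>euclidean_space\<close>, whose norm comes from an inner product,
  so their counterparts for an arbitrary norm are defined here.
\<close>

definition numerical_radius :: "('a::real_normed_vector \<Rightarrow>\<^sub>L 'a) \<Rightarrow> real" where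
  "numerical_radius T =
     Sup {\<bar>blinfun_apply g (blinfun_apply T x)\<bar> | (x :: 'a) (g :: 'a \<Rightarrow>\<^sub>L real).
            norm x = 1 \<and> norm g = 1 \<and> blinfun_apply g x = 1}"

definition numerical_index :: "'a::real_normed_vector itself \<Rightarrow> real" where
  "numerical_index _ = Inf {numerical_radius T | (T :: 'a \<Rightarrow>\<^sub>L 'a). norm T = 1}"

definition unit_ball_vertices :: "'a::real_normed_vector set" where
  "unit_ball_vertices = {x. x extreme_point_of cball 0 1}"

definition polyhedral_space :: "'a::real_normed_vector itself \<Rightarrow> bool" where
  "polyhedral_space _ \<longleftrightarrow>
     (\<exists>B :: 'a set. finite B \<and> span B = UNIV) \<and> finite (unit_ball_vertices :: 'a set)"

definition closed_halfspace :: "'a::real_normed_vector set \<Rightarrow> bool" where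
  "closed_halfspace M \<longleftrightarrow>
     (\<exists>(g :: 'a \<Rightarrow>\<^sub>L real) c. g \<noteq> 0 \<and> M = {x. blinfun_apply g x \<le> c})"

definition nvs_polyhedron :: "'a::real_normed_vector set \<Rightarrow> bool" where
  "nvs_polyhedron P \<longleftrightarrow>
     P \<noteq> {} \<and> compact P \<and> (\<exists>H. finite H \<and> (\<forall>M\<in>H. closed_halfspace M) \<and> P = \<Inter>H)"

definition nvs_polyhedron_dim :: "'a::real_normed_vector set \<Rightarrow> nat" where
  "nvs_polyhedron_dim P = dim (span {v - w | v w. v \<in> P \<and> w \<in> P})"

definition nvs_face :: "'a::real_normed_vector set \<Rightarrow> 'a set \<Rightarrow> bool" where
  "nvs_face Q P \<longleftrightarrow>
     nvs_polyhedron Q \<and>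
     (Q = P \<or> (\<exists>M. closed_halfspace M \<and> P \<subseteq> M \<and> Q = P \<inter> frontier M))"

text \<open>The dimension condition is \<open>dim F = dim X - 1\<close>, written without truncated subtraction.\<close>

definition unit_ball_facet :: "'a::real_normed_vector set \<Rightarrow> bool" where
  "unit_ball_facet F \<longleftrightarrow>
     nvs_face F (cball 0 1) \<and> nvs_polyhedron_dim F + 1 = dim (UNIV :: 'a set)"

definition supporting_functional ::
    "('a::real_normed_vector \<Rightarrow>\<^sub>L real) \<Rightarrow> 'a set \<Rightarrow> bool" where
  "supporting_functional f F \<longleftrightarrow>
     norm f = 1 \<and>
     (\<exists>v\<in>F. blinfun_apply f v = norm f \<and>
            F = {v + k | k. blinfun_apply f k = 0} \<inter> sphere 0 1)"

end

theory Submission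
  imports Defs
begin

text \<open>
  Let \<open>T\<close> be an operator of norm 1. The function \<open>x \<mapsto> \<parallel>T x\<parallel>\<close> is convex and continuous and the unit
  ball is compact, so by Bauer's maximum principle (\<open>bauer_maximum_principle\<close>) the norm of \<open>T\<close> is
  attained at an extreme point of the ball, that is, at some \<open>\<plusminus>v i\<close>
  (\<open>operator_norm_attained_at_extreme_point\<close>). Hence \<open>T (v i)\<close> is a unit vector and, by the definition
  of \<open>\<kappa> i\<close>, some \<open>f i r\<close> satisfies \<open>\<bar>f i r (T (v i))\<bar> \<ge> \<kappa> i\<close>. Since the facet \<open>F i r\<close> contains \<open>v i\<close>, the
  pair \<open>(v i, f i r)\<close> competes in the supremum that defines the numerical radius of \<open>T\<close>, which is
  therefore at least \<open>\<kappa> i\<close>.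

  The minimum in the definition of \<open>\<kappa> i\<close> is attained at a unit vector, so \<open>\<kappa> i > 0\<close> as soon as the
  functionals \<open>f i 1, \<dots>, f i n\<close> have no common zero but the origin. For \<open>n\<close> independent functionals
  on an \<open>n\<close>-dimensional space this is linear algebra (\<open>independent_functionals_separate\<close>). When
  \<open>n \<le> 3\<close> independence is automatic (\<open>at_most_three_facet_functionals_independent\<close>): all the
  functionals take the value 1 at \<open>v i\<close>, so a linear relation between two of them makes them equal
  and one among three distinct ones puts one of them strictly between the other two, whereas the
  supporting functional of a facet is never a proper convex combination of two distinct functionals
  in the dual ball (\<open>facet_functional_extreme\<close>). From dimension 4
  on, distinct facets at a vertex can have dependent functionals: at the vertex \<open>(1,0,0,1)\<close> of the
  unit ball of \<open>max (\<bar>x\<bar> + \<bar>y\<bar> + \<bar>z\<bar>) \<bar>w\<bar>\<close>, the four functionals \<open>x \<plusminus> y \<plusminus> z\<close> all vanish on the \<open>w\<close>-axis.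
\<close>

section \<open>Finite-dimensional normed spaces\<close>

text \<open>The \<open>\<ell>\<^sup>1\<close>-norm of the coordinates is dominated by the given norm. This is the compactness
  argument behind the equivalence of norms: on the \<open>\<ell>\<^sup>1\<close>-sphere of coefficient families, a compact subset
  of a cube, the given norm has a positive minimum, and the general case follows by scaling.\<close>

lemma independent_norm_lower_bound:
  fixes E :: "'a::real_normed_vector set"
  assumes "finite E" "independent E"
  obtains c where "c > 0"
    "\<And>a. c * (\<Sum>b\<in>E. \<bar>a b\<bar>) \<le> norm (\<Sum>b\<in>E. a b *\<^sub>R b)"
proof (cases "E = {}")
  case True
  then show ?thesis by (intro that[of 1]) auto
next
  case False
  define S where "S = {a \<in> PiE E (\<lambda>_. {-1..1::real}). (\<Sum>b\<in>E. \<bar>a b\<bar>) = 1}"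
  have cube: "compact (PiE E (\<lambda>_. {-1..1::real}) :: ('a \<Rightarrow> real) set)"
  proof -
    \<comment> \<open>Functions in \<open>PiE E\<close> are \<open>undefined\<close> off \<open>E\<close>, so as a full product the cube has singleton
      factors there.\<close>
    have "compactin (product_topology (\<lambda>_. euclidean) UNIV)
            (PiE UNIV (\<lambda>b. if b \<in> E then {-1..1::real} else {undefined}))"
      by (subst compactin_PiE) auto
    moreover have "PiE UNIV (\<lambda>b. if b \<in> E then {-1..1::real} else {undefined}) = PiE E (\<lambda>_. {-1..1})"
      by (force simp: PiE_def Pi_def extensional_def split: if_splits)
    ultimately show ?thesis
      unfolding euclidean_product_topology by simp
  qed
  have "compact S"
  proof -
    have "closed {a :: 'a \<Rightarrow> real. (\<Sum>b\<in>E. \<bar>a b\<bar>) = 1}"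
      by (intro closed_Collect_eq continuous_on_sum continuous_on_rabs
          continuous_on_product_coordinates continuous_on_const)
    from compact_Int_closed[OF cube this] show ?thesis
      unfolding S_def by (simp add: Int_def)
  qed
  moreover have "S \<noteq> {}"
  proof -
    from False obtain e where e: "e \<in> E" by auto
    have "(\<Sum>b\<in>E. \<bar>if b = e then 1 else 0 :: real\<bar>) = (\<Sum>b\<in>E. if b = e then 1 else 0)"
      by (intro sum.cong) auto
    then have "(\<lambda>b\<in>E. if b = e then 1 else 0) \<in> S"
      using e assms by (auto simp: S_def)
    then show ?thesis by auto
  qed
  moreover have "continuous_on S (\<lambda>a. norm (\<Sum>b\<in>E. a b *\<^sub>R b))"
    by (rule continuous_on_subset[OF _ subset_UNIV], intro continuous_on_norm continuous_on_sum
        continuous_on_scaleR continuous_on_product_coordinates continuous_on_const)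
  ultimately obtain s where s: "s \<in> S"
    and min: "\<And>a. a \<in> S \<Longrightarrow> norm (\<Sum>b\<in>E. s b *\<^sub>R b) \<le> norm (\<Sum>b\<in>E. a b *\<^sub>R b)"
    using continuous_attains_inf[of S "\<lambda>a. norm (\<Sum>b\<in>E. a b *\<^sub>R b)"] by blast
  let ?c = "norm (\<Sum>b\<in>E. s b *\<^sub>R b)"
  have "(\<Sum>b\<in>E. s b *\<^sub>R b) \<noteq> 0"
  proof
    assume "(\<Sum>b\<in>E. s b *\<^sub>R b) = 0"
    then have "\<forall>b\<in>E. s b = 0"
      using assms dependent_finite by blast
    then show False using s by (simp add: S_def)
  qed
  then have "?c > 0" by simp
  moreover have "?c * (\<Sum>b\<in>E. \<bar>a b\<bar>) \<le> norm (\<Sum>b\<in>E. a b *\<^sub>R b)" for a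
  proof -
    define r where "r = (\<Sum>b\<in>E. \<bar>a b\<bar>)"
    show ?thesis
    proof (cases "r = 0")
      case True
      then show ?thesis by (simp add: r_def)
    next
      case False
      moreover have "r \<ge> 0" by (simp add: r_def sum_nonneg)
      ultimately have r: "r > 0" by simp
      have le: "a b \<le> r" "- r \<le> a b" if "b \<in> E" for b
        using member_le_sum[OF that, of "\<lambda>b. \<bar>a b\<bar>"] assms(1) by (simp_all add: r_def abs_le_iff)
      have "(\<lambda>b\<in>E. a b / r) \<in> S"
        unfolding S_def using r le
        by (auto simp: field_simps r_def[symmetric] simp flip: sum_divide_distrib)
      from min[OF this] have "?c \<le> norm (\<Sum>b\<in>E. (a b / r) *\<^sub>R b)" by simp
      also have "(\<Sum>b\<in>E. (a b / r) *\<^sub>R b) = (1 / r) *\<^sub>R (\<Sum>b\<in>E. a b *\<^sub>R b)"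
        by (simp add: scaleR_sum_right)
      finally show ?thesis using r by (simp add: r_def[symmetric] field_simps)
    qed
  qed
  ultimately show ?thesis by (rule that)
qed

lemma coordinate_functionals:
  fixes E :: "'a::real_normed_vector set"
  assumes "finite E" "independent E" "span E = UNIV"
  obtains e :: "'a \<Rightarrow> 'a \<Rightarrow>\<^sub>L real" where
    "\<And>x. (\<Sum>b\<in>E. blinfun_apply (e b) x *\<^sub>R b) = x"
proof -
  obtain c where c: "c > 0"
    "\<And>a. c * (\<Sum>b\<in>E. \<bar>a b\<bar>) \<le> norm (\<Sum>b\<in>E. a b *\<^sub>R b)"
    using independent_norm_lower_bound[OF assms(1,2)] by blast
  have sum: "(\<Sum>b\<in>E. representation E x b *\<^sub>R b) = x" for x
    using assms by (intro real_vector.sum_representation_eq) auto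
  have lin: "bounded_linear (\<lambda>x. representation E x b)" if "b \<in> E" for b
  proof (rule bounded_linear_intro)
    fix x
    have "\<bar>representation E x b\<bar> \<le> (\<Sum>b\<in>E. \<bar>representation E x b\<bar>)"
      using member_le_sum[OF that, of "\<lambda>b. \<bar>representation E x b\<bar>"] assms(1) by simp
    also have "\<dots> \<le> norm x * (1 / c)"
      using c(2)[of "representation E x"] c(1) sum[of x] by (simp add: field_simps)
    finally show "norm (representation E x b) \<le> norm x * (1 / c)" by simp
  qed (use assms in \<open>auto simp: real_vector.representation_add real_vector.representation_scale\<close>)
  show ?thesis
  proof (rule that[of "\<lambda>b. Blinfun (\<lambda>x. representation E x b)"])
    show "(\<Sum>b\<in>E. blinfun_apply (Blinfun (\<lambda>x. representation E x b)) x *\<^sub>R b) = x" for x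
      using sum[of x] lin by (simp add: bounded_linear_Blinfun_apply)
  qed
qed

lemma compact_cball_finite_span:
  fixes E :: "'a::real_normed_vector set"
  assumes "finite E" "independent E" "span E = UNIV"
  shows "compact (cball (0::'a) r)"
proof -
  obtain e :: "'a \<Rightarrow> 'a \<Rightarrow>\<^sub>L real" where e: "\<And>x. (\<Sum>b\<in>E. blinfun_apply (e b) x *\<^sub>R b) = x"
    using coordinate_functionals[OF assms] by metis
  \<comment> \<open>The coordinates of a point of the ball lie in the box with these sides.\<close>
  define R where "R b = {- (norm (e b) * r)..norm (e b) * r}" for b
  define Q where "Q = PiE UNIV (\<lambda>b. if b \<in> E then R b else {0})"
  have "compact Q"
    unfolding compactin_euclidean_iff[symmetric] euclidean_product_topology[symmetric] Q_def
    by (subst compactin_PiE) (auto simp: R_def)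
  moreover have "continuous_on Q (\<lambda>a. \<Sum>b\<in>E. a b *\<^sub>R b)"
    by (rule continuous_on_subset[OF _ subset_UNIV], intro continuous_on_sum continuous_on_scaleR
        continuous_on_product_coordinates continuous_on_const)
  ultimately have "compact ((\<lambda>a. \<Sum>b\<in>E. a b *\<^sub>R b) ` Q)"
    by (intro compact_continuous_image)
  moreover have sub: "cball 0 r \<subseteq> (\<lambda>a. \<Sum>b\<in>E. a b *\<^sub>R b) ` Q"
  proof
    fix x :: 'a assume "x \<in> cball 0 r"
    then have "\<bar>blinfun_apply (e b) x\<bar> \<le> norm (e b) * r" for b
      using norm_blinfun[of "e b" x] by simp (meson mult_left_mono norm_ge_zero order_trans)
    then have "blinfun_apply (e b) x \<in> R b" for b
      by (metis R_def abs_le_iff atLeastAtMost_iff minus_le_iff)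
    then have "(\<lambda>b. if b \<in> E then blinfun_apply (e b) x else 0) \<in> Q"
      by (auto simp: Q_def)
    then have "(\<Sum>b\<in>E. (if b \<in> E then blinfun_apply (e b) x else 0) *\<^sub>R b) \<in> (\<lambda>a. \<Sum>b\<in>E. a b *\<^sub>R b) ` Q"
      by (rule imageI)
    then show "x \<in> (\<lambda>a. \<Sum>b\<in>E. a b *\<^sub>R b) ` Q" by (simp add: e)
  qed
  ultimately have "compact ((\<lambda>a. \<Sum>b\<in>E. a b *\<^sub>R b) ` Q \<inter> cball 0 r)"
    by (intro compact_Int_closed closed_cball)
  then show ?thesis
    using sub by (simp add: Int_absorb1)
qed

text \<open>The functionals that vanish at a nonzero \<open>x\<close> form a space of dimension one less than the dual:
  in a basis \<open>B\<close> containing \<open>x\<close> they are combinations of the coordinate functionals of \<open>B - {x}\<close>.\<close>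

lemma independent_functionals_separate:
  fixes E :: "'a::real_normed_vector set" and G :: "('a \<Rightarrow>\<^sub>L real) set"
  assumes "finite E" "independent E" "span E = UNIV"
    and "independent G" "card G = card E"
    and vanish: "\<And>g. g \<in> G \<Longrightarrow> blinfun_apply g x = 0"
  shows "x = 0"
proof (rule ccontr)
  assume "x \<noteq> 0"
  then have "independent {x}" by simp
  then obtain B where B: "{x} \<subseteq> B" "independent B" "span B = UNIV"
    by (metis extend_basis_superset independent_extend_basis span_extend_basis)
  have bnd: "finite B" "card B \<le> card E"
    using independent_span_bound[of E B] assms B by auto
  obtain e :: "'a \<Rightarrow> 'a \<Rightarrow>\<^sub>L real" where e: "\<And>y. (\<Sum>b\<in>B. blinfun_apply (e b) y *\<^sub>R b) = y"
    using coordinate_functionals[OF bnd(1) B(2,3)] by metis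
  have "G \<subseteq> span (e ` (B - {x}))"
  proof
    fix g assume "g \<in> G"
    have "g = (\<Sum>b\<in>B - {x}. blinfun_apply g b *\<^sub>R e b)"
    proof (rule blinfun_eqI)
      fix y
      have "blinfun_apply g y = blinfun_apply g (\<Sum>b\<in>B. blinfun_apply (e b) y *\<^sub>R b)"
        by (simp add: e)
      also have "\<dots> = (\<Sum>b\<in>B. blinfun_apply (e b) y * blinfun_apply g b)"
        by (simp add: blinfun.sum_right blinfun.scaleR_right)
      also have "\<dots> = (\<Sum>b\<in>B - {x}. blinfun_apply (e b) y * blinfun_apply g b)"
        using vanish[OF \<open>g \<in> G\<close>] bnd(1) by (intro sum.mono_neutral_right) auto
      finally show "blinfun_apply g y = blinfun_apply (\<Sum>b\<in>B - {x}. blinfun_apply g b *\<^sub>R e b) y"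
        by (simp add: blinfun.sum_left blinfun.scaleR_left mult.commute)
    qed
    also have "\<dots> \<in> span (e ` (B - {x}))"
      by (intro span_sum span_scale span_base) auto
    finally show "g \<in> span (e ` (B - {x}))" .
  qed
  then have "card G \<le> card (e ` (B - {x}))"
    using independent_span_bound[of "e ` (B - {x})" G] assms bnd by auto
  also have "\<dots> \<le> card (B - {x})"
    using bnd by (intro card_image_le) auto
  also have "\<dots> < card B"
    using B bnd by (intro psubset_card_mono) auto
  finally show False using assms bnd by simp
qed

section \<open>Bauer's maximum principle\<close>

text \<open>This is the relation \<open>face_of\<close> for sets that may fail to be convex. The maximisers of a convex
  function are in general such a set: the norm, on the unit ball, is maximal exactly on the sphere.\<close>

definition extremal_subset :: "'a::real_vector set \<Rightarrow> 'a set \<Rightarrow> bool" where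
  "extremal_subset E K \<longleftrightarrow> E \<subseteq> K \<and>
     (\<forall>a\<in>K. \<forall>b\<in>K. \<forall>t. 0 < t \<and> t < 1 \<and> (1 - t) *\<^sub>R a + t *\<^sub>R b \<in> E \<longrightarrow> a \<in> E \<and> b \<in> E)"

text \<open>A convex function that is maximal at an interior point of a segment is maximal at both ends.
  Convexity is asked only at points of \<open>E\<close>, whose segments may leave \<open>E\<close>.\<close>

lemma extremal_subset_argmax:
  fixes p :: "'a::real_vector \<Rightarrow> real"
  assumes "extremal_subset E K"
    and conv: "\<And>a b t. a \<in> E \<Longrightarrow> b \<in> E \<Longrightarrow> 0 < t \<Longrightarrow> t < 1 \<Longrightarrow>
      p ((1 - t) *\<^sub>R a + t *\<^sub>R b) \<le> (1 - t) * p a + t * p b"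
  shows "extremal_subset {x \<in> E. \<forall>y\<in>E. p y \<le> p x} K"
  unfolding extremal_subset_def
proof (intro conjI ballI allI impI)
  show "{x \<in> E. \<forall>y\<in>E. p y \<le> p x} \<subseteq> K"
    using assms(1) by (auto simp: extremal_subset_def)
  fix a b t
  assume "a \<in> K" "b \<in> K"
  define z where "z = (1 - t) *\<^sub>R a + t *\<^sub>R b"
  assume "0 < t \<and> t < 1 \<and> (1 - t) *\<^sub>R a + t *\<^sub>R b \<in> {x \<in> E. \<forall>y\<in>E. p y \<le> p x}"
  then have t: "0 < t" "t < 1" and z: "z \<in> E" "\<And>y. y \<in> E \<Longrightarrow> p y \<le> p z"
    by (auto simp: z_def)
  have ab: "a \<in> E" "b \<in> E"
    using assms(1) \<open>a \<in> K\<close> \<open>b \<in> K\<close> t z(1) unfolding extremal_subset_def z_def by blast+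
  have le: "p z \<le> (1 - t) * p a + t * p b"
    unfolding z_def by (rule conv) (use ab t in auto)
  have "p z \<le> p a"
  proof (rule ccontr)
    assume "\<not> p z \<le> p a"
    then have "(1 - t) * p a + t * p b < (1 - t) * p z + t * p z"
      using t z(2)[OF ab(2)] by (intro add_less_le_mono) auto
    then show False using le by (simp add: algebra_simps)
  qed
  moreover have "p z \<le> p b"
  proof (rule ccontr)
    assume "\<not> p z \<le> p b"
    then have "(1 - t) * p a + t * p b < (1 - t) * p z + t * p z"
      using t z(2)[OF ab(1)] by (intro add_le_less_mono) auto
    then show False using le by (simp add: algebra_simps)
  qed
  ultimately show "a \<in> {x \<in> E. \<forall>y\<in>E. p y \<le> p x}" "b \<in> {x \<in> E. \<forall>y\<in>E. p y \<le> p x}"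
    using ab z(2) by force+
qed

lemma compact_argmax:
  fixes p :: "'a::t2_space \<Rightarrow> real"
  assumes "compact E" "E \<noteq> {}" "continuous_on E p"
  shows "compact {x \<in> E. \<forall>y\<in>E. p y \<le> p x}" "{x \<in> E. \<forall>y\<in>E. p y \<le> p x} \<noteq> {}"
proof -
  obtain x where x: "x \<in> E" "\<And>y. y \<in> E \<Longrightarrow> p y \<le> p x"
    using continuous_attains_sup[OF assms] by blast
  then show "{x \<in> E. \<forall>y\<in>E. p y \<le> p x} \<noteq> {}" by blast
  have "closedin (top_of_set E) {y \<in> E. p y = p x}"
    by (rule continuous_closedin_preimage_constant[OF assms(3)])
  moreover have "{y \<in> E. p y = p x} = {x \<in> E. \<forall>y\<in>E. p y \<le> p x}"
    using x by (auto intro: antisym)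
  ultimately show "compact {x \<in> E. \<forall>y\<in>E. p y \<le> p x}"
    using assms(1) closedin_compact by metis
qed

text \<open>Start from the compact extremal set of maximisers of \<open>p\<close> and maximise the coordinates over it
  one after the other. Each step leaves a nonempty compact extremal subset on which one more
  coordinate is constant; at the end a single point remains, and it is extreme.\<close>

lemma bauer_maximum_principle:
  fixes E K :: "'a::real_normed_vector set"
  assumes "finite E" "independent E" "span E = UNIV"
    and "compact K" "K \<noteq> {}" "convex_on K p" "continuous_on K p"
  obtains x where "x extreme_point_of K" "\<And>y. y \<in> K \<Longrightarrow> p y \<le> p x"
proof -
  obtain e :: "'a \<Rightarrow> 'a \<Rightarrow>\<^sub>L real" where e: "\<And>x. (\<Sum>b\<in>E. blinfun_apply (e b) x *\<^sub>R b) = x"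
    using coordinate_functionals[OF assms(1-3)] by metis
  let ?A = "{x \<in> K. \<forall>y\<in>K. p y \<le> p x}"
  have "extremal_subset K K" by (simp add: extremal_subset_def)
  then have A: "extremal_subset ?A K"
  proof (rule extremal_subset_argmax)
    fix a b and t :: real assume "a \<in> K" "b \<in> K" "0 < t" "t < 1"
    with assms(6) show "p ((1 - t) *\<^sub>R a + t *\<^sub>R b) \<le> (1 - t) * p a + t * p b"
      unfolding convex_on_def by simp
  qed
  have "\<exists>D\<subseteq>?A. D \<noteq> {} \<and> compact D \<and> extremal_subset D K \<and>
          (\<forall>b\<in>C. \<forall>x\<in>D. \<forall>y\<in>D. blinfun_apply (e b) x = blinfun_apply (e b) y)"
    if "finite C" for C
    using that
  proof induction
    case empty
    show ?case using compact_argmax[OF assms(4,5,7)] A by blast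
  next
    case (insert c C)
    then obtain D where D: "D \<subseteq> ?A" "D \<noteq> {}" "compact D" "extremal_subset D K"
      "\<forall>b\<in>C. \<forall>x\<in>D. \<forall>y\<in>D. blinfun_apply (e b) x = blinfun_apply (e b) y" by blast
    let ?D = "{x \<in> D. \<forall>y\<in>D. blinfun_apply (e c) y \<le> blinfun_apply (e c) x}"
    have "compact ?D" "?D \<noteq> {}"
      by (intro compact_argmax D continuous_intros)+
    moreover have "extremal_subset ?D K"
      using D(4) by (rule extremal_subset_argmax) (simp add: blinfun.bilinear_simps)
    moreover have "\<forall>b\<in>insert c C. \<forall>x\<in>?D. \<forall>y\<in>?D. blinfun_apply (e b) x = blinfun_apply (e b) y"
      using D(5) by (auto intro: antisym)
    moreover have "?D \<subseteq> ?A" using D(1) by blast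
    ultimately show ?case by (intro exI[of _ ?D] conjI)
  qed
  from this[OF assms(1)] obtain D where D: "D \<subseteq> ?A" "D \<noteq> {}" "extremal_subset D K"
    and const: "\<And>b x y. b \<in> E \<Longrightarrow> x \<in> D \<Longrightarrow> y \<in> D \<Longrightarrow> blinfun_apply (e b) x = blinfun_apply (e b) y"
    by blast
  have single: "x = y" if "x \<in> D" "y \<in> D" for x y
  proof -
    have "x = (\<Sum>b\<in>E. blinfun_apply (e b) x *\<^sub>R b)" by (rule e[symmetric])
    also have "\<dots> = (\<Sum>b\<in>E. blinfun_apply (e b) y *\<^sub>R b)"
      using const[OF _ that] by (intro sum.cong refl) simp
    also have "\<dots> = y" by (rule e)
    finally show ?thesis .
  qed
  from D(2) obtain x where x: "x \<in> D" by blast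
  have "x extreme_point_of K"
    unfolding extreme_point_of_def
  proof (intro conjI ballI notI)
    show "x \<in> K" using x D(1) by blast
    fix a b assume "a \<in> K" "b \<in> K" "x \<in> open_segment a b"
    then obtain t where "a \<noteq> b" "0 < t" "t < 1" "x = (1 - t) *\<^sub>R a + t *\<^sub>R b"
      by (auto simp: in_segment)
    then have "a \<in> D" "b \<in> D"
      using D(3) x \<open>a \<in> K\<close> \<open>b \<in> K\<close> unfolding extremal_subset_def by blast+
    then show False using single \<open>a \<noteq> b\<close> by blast
  qed
  then show ?thesis using that x D(1) by blast
qed

section \<open>Supporting functionals of facets\<close>

lemma supporting_functionalD:
  assumes "supporting_functional f F"
  shows "norm f = 1" "F = {x. blinfun_apply f x = 1} \<inter> sphere 0 1"
proof -
  from assms show f: "norm f = 1" by (simp add: supporting_functional_def)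
  from assms obtain v where v: "blinfun_apply f v = 1"
    "F = {v + k | k. blinfun_apply f k = 0} \<inter> sphere 0 1"
    by (auto simp: supporting_functional_def)
  have "{v + k | k. blinfun_apply f k = 0} = {x. blinfun_apply f x = 1}"
  proof (intro set_eqI iffI)
    fix x assume "x \<in> {x. blinfun_apply f x = 1}"
    then have "x = v + (x - v)" "blinfun_apply f (x - v) = 0"
      using v by (auto simp: blinfun.diff_right)
    then show "x \<in> {v + k | k. blinfun_apply f k = 0}" by blast
  qed (auto simp: blinfun.add_right v)
  with v show "F = {x. blinfun_apply f x = 1} \<inter> sphere 0 1" by simp
qed

text \<open>A facet determines its supporting hyperplane. A functional that is 1 on \<open>F\<close> kills the differences
  of points of \<open>F\<close>, which span a hyperplane, and it is prescribed at \<open>v\<close>, which lies off that hyperplane.\<close>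

lemma functional_eq_on_facet:
  fixes F E :: "'a::real_normed_vector set" and g h :: "'a \<Rightarrow>\<^sub>L real"
  assumes "finite E" "independent E" "span E = UNIV"
    and facet: "unit_ball_facet F" and "v \<in> F"
    and g: "\<And>x. x \<in> F \<Longrightarrow> blinfun_apply g x = 1"
    and h: "\<And>x. x \<in> F \<Longrightarrow> blinfun_apply h x = 1"
  shows "g = h"
proof -
  define D where "D = {x - y | x y. x \<in> F \<and> y \<in> F}"
  obtain C where C: "C \<subseteq> D" "independent C" "D \<subseteq> span C" "card C = dim D"
    using basis_exists[of D] by blast
  have finC: "finite C"
    using independent_span_bound[OF assms(1) C(2)] assms(3) by auto
  have dim: "dim (UNIV :: 'a set) = card E"
    using dim_eq_card[of E UNIV] assms(2,3) by simp
  have card: "card C + 1 = card E"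
  proof -
    have "nvs_polyhedron_dim F = dim D"
      unfolding nvs_polyhedron_dim_def D_def by (rule dim_span)
    then show ?thesis
      using facet dim C(4) unfolding unit_ball_facet_def by linarith
  qed
  have kill: "blinfun_apply k x = 0"
    if "x \<in> span C" "\<And>x. x \<in> F \<Longrightarrow> blinfun_apply k x = 1"
    for x and k :: "'a \<Rightarrow>\<^sub>L real"
    using that(1)
  proof (induction rule: span_induct_alt)
    case base
    then show ?case by simp
  next
    case (step c x y)
    then obtain p q where "x = p - q" "p \<in> F" "q \<in> F" using C(1) by (auto simp: D_def)
    with step that(2) show ?case by (simp add: blinfun.bilinear_simps)
  qed
  have "v \<notin> span C"
  proof
    assume "v \<in> span C"
    from kill[OF this, of g] g g[OF \<open>v \<in> F\<close>] show False by simp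
  qed
  then have "v \<notin> C" using span_base by blast
  with \<open>v \<notin> span C\<close> have ind: "independent (insert v C)"
    using C(2) by (simp add: independent_insert)
  have all: "x \<in> span (insert v C)" for x
  proof (rule ccontr)
    assume x: "x \<notin> span (insert v C)"
    then have "x \<notin> insert v C" using span_base by blast
    with x ind have "independent (insert x (insert v C))"
      by (subst independent_insert) simp
    then have "card (insert x (insert v C)) \<le> card E"
      using independent_span_bound[OF assms(1)] assms(3) by simp
    then show False
      using \<open>x \<notin> insert v C\<close> \<open>v \<notin> C\<close> card finC by simp
  qed
  show ?thesis
  proof (rule blinfun_eqI)
    fix x
    obtain c where "x - c *\<^sub>R v \<in> span C"
      using all[of x] unfolding span_breakdown_eq by blast
    then show "blinfun_apply g x = blinfun_apply h x"
      using kill[of "x - c *\<^sub>R v" g] kill[of "x - c *\<^sub>R v" h] g h \<open>v \<in> F\<close>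
      by (simp add: blinfun.bilinear_simps)
  qed
qed

text \<open>At a point of the facet, \<open>f\<close> attains the value 1, which neither \<open>g\<close> nor \<open>h\<close> can exceed there; so
  both equal 1 on the whole facet and \<open>functional_eq_on_facet\<close> applies.\<close>

lemma facet_functional_extreme:
  fixes E F :: "'a::real_normed_vector set"
  assumes "finite E" "independent E" "span E = UNIV"
    and "unit_ball_facet F" "supporting_functional f F"
    and gh: "norm g \<le> 1" "norm h \<le> 1" and "0 < t" "t < 1"
    and comb: "f = t *\<^sub>R g + (1 - t) *\<^sub>R h"
  shows "g = h"
proof -
  have F: "F = {x. blinfun_apply f x = 1} \<inter> sphere 0 1"
    using assms(5) by (rule supporting_functionalD)
  obtain v where "v \<in> F" using assms(5) by (auto simp: supporting_functional_def)
  have "blinfun_apply g x = 1 \<and> blinfun_apply h x = 1" if "x \<in> F" for x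
  proof -
    have x: "norm x = 1" "t * blinfun_apply g x + (1 - t) * blinfun_apply h x = 1"
      using that comb unfolding F by (auto simp: blinfun.bilinear_simps)
    have "\<bar>blinfun_apply k x\<bar> \<le> 1" if "norm k \<le> 1" for k :: "'a \<Rightarrow>\<^sub>L real"
      using norm_blinfun[of k x] that x(1) by simp
    with gh have le: "blinfun_apply g x \<le> 1" "blinfun_apply h x \<le> 1"
      by (meson abs_le_D1)+
    have eq: "t * (1 - blinfun_apply g x) + (1 - t) * (1 - blinfun_apply h x) = 0"
      using x(2) by (simp add: algebra_simps)
    have "t * (1 - blinfun_apply g x) = 0 \<and> (1 - t) * (1 - blinfun_apply h x) = 0"
      using eq le \<open>0 < t\<close> \<open>t < 1\<close> by (subst (asm) add_nonneg_eq_0_iff) auto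
    then show ?thesis using \<open>0 < t\<close> \<open>t < 1\<close> by simp
  qed
  then show ?thesis
    using functional_eq_on_facet[OF assms(1-4) \<open>v \<in> F\<close>] by blast
qed

text \<open>Evaluation at the common vertex turns a linear relation \<open>a = t g + s h\<close> into an affine one,
  \<open>t + s = 1\<close>. Three points on a line have one in the middle; the case distinction on \<open>t\<close> says which,
  and \<open>facet_functional_extreme\<close> excludes each case.\<close>

lemma at_most_three_facet_functionals_independent:
  fixes E :: "'a::real_normed_vector set" and G :: "('a \<Rightarrow>\<^sub>L real) set"
  assumes "finite E" "independent E" "span E = UNIV"
    and "finite G" "card G \<le> 3"
    and facet: "\<And>g. g \<in> G \<Longrightarrow> \<exists>F. unit_ball_facet F \<and> supporting_functional g F \<and> v \<in> F"
  shows "independent G"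
proof
  assume "dependent G"
  then obtain a where a: "a \<in> G" "a \<in> span (G - {a})" by (auto simp: dependent_def)
  have one: "norm g = 1" "blinfun_apply g v = 1" if "g \<in> G" for g
    using facet[OF that] supporting_functionalD by blast+
  have no_comb: "k = l" if "k \<in> G" "l \<in> G" "f \<in> G" "0 < t" "t < 1" "f = t *\<^sub>R k + (1 - t) *\<^sub>R l" for f k l t
    using facet[OF that(3)] facet_functional_extreme[OF assms(1-3), of _ f k l t] one that by auto
  have "G - {a} \<noteq> {}"
  proof
    assume "G - {a} = {}"
    with a(2) have "a = 0" by simp
    then show False using one(1)[OF a(1)] by simp
  qed
  then obtain g where g: "g \<in> G" "g \<noteq> a" by auto
  \<comment> \<open>With only two functionals in \<open>G\<close> the choice is \<open>h = g\<close>, which the cases below cover as well.\<close>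
  have "\<exists>h\<in>G. h \<noteq> a \<and> G - {a} \<subseteq> {g, h}"
  proof (cases "G - {a} \<subseteq> {g}")
    case True
    then show ?thesis using g by blast
  next
    case False
    then obtain h where h: "h \<in> G" "h \<noteq> a" "h \<noteq> g" by blast
    have "card {a, g, h} = 3" using h g by auto
    then have "G = {a, g, h}"
      using card_seteq[OF assms(4), of "{a,g,h}"] assms(5) a(1) g(1) h(1) by simp
    then show ?thesis using h by blast
  qed
  then obtain h where h: "h \<in> G" "h \<noteq> a" "G - {a} \<subseteq> {g, h}" by blast
  from a(2) h(3) have "a \<in> span {g, h}" using span_mono by blast
  then obtain t s where "a - t *\<^sub>R g - s *\<^sub>R h = 0"
    by (auto simp: span_breakdown_eq)
  then have comb0: "a = t *\<^sub>R g + s *\<^sub>R h" by (simp add: algebra_simps)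
  then have "blinfun_apply a v = t * blinfun_apply g v + s * blinfun_apply h v"
    by (simp add: blinfun.bilinear_simps)
  then have s: "s = 1 - t" using one a(1) g(1) h(1) by simp
  note comb = comb0[unfolded s]
  consider "t = 0" | "t = 1" | "0 < t" "t < 1" | "t < 0" | "t > 1" by linarith
  then show False
  proof cases
    case 1
    then show False using comb h by simp
  next
    case 2
    then show False using comb g by simp
  next
    case 3
    then have "g = h" using no_comb comb a g h by blast
    then show False using comb h by (simp flip: scaleR_left_distrib)
  next
    case 4
    \<comment> \<open>Here \<open>h\<close> is the middle point; solve the relation for it.\<close>
    define u where "u = 1 / (1 - t)"
    have u: "0 < u" "u < 1" "u * (1 - t) = 1" using 4 by (auto simp: u_def)
    have "u *\<^sub>R a + (1 - u) *\<^sub>R g = (u * t + 1 - u) *\<^sub>R g + (u * (1 - t)) *\<^sub>R h"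
      by (subst comb) (simp add: algebra_simps)
    also have "u * t + 1 - u = 0" using u(3) by (simp add: algebra_simps)
    finally have "h = u *\<^sub>R a + (1 - u) *\<^sub>R g" using u(3) by simp
    then show False using no_comb[OF a(1) g(1) h(1) u(1,2)] g by blast
  next
    case 5
    \<comment> \<open>Here \<open>g\<close> is the middle point.\<close>
    define u where "u = 1 / t"
    have u: "0 < u" "u < 1" "u * t = 1" using 5 by (auto simp: u_def)
    have "u *\<^sub>R a + (1 - u) *\<^sub>R h = (u * t) *\<^sub>R g + (1 - u * t) *\<^sub>R h"
      by (subst comb) (simp add: algebra_simps)
    then have "g = u *\<^sub>R a + (1 - u) *\<^sub>R h" using u(3) by simp
    then show False using no_comb[OF a(1) h(1) g(1) u(1,2)] h by blast
  qed
qed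

section \<open>Minima and maxima of continuous functions\<close>

text \<open>\<open>LEAST\<close> on the reals names a value only where a minimum exists; compactness supplies one.\<close>

lemma Least_in_image_attained:
  fixes p :: "'a::topological_space \<Rightarrow> real"
  assumes "compact S" "S \<noteq> {}" "continuous_on S p"
  obtains x where "x \<in> S" "(LEAST t. t \<in> p ` S) = p x" "\<And>y. y \<in> S \<Longrightarrow> p x \<le> p y"
proof -
  obtain x where x: "x \<in> S" "\<And>y. y \<in> S \<Longrightarrow> p x \<le> p y"
    using continuous_attains_inf[OF assms] by blast
  then have "(LEAST t. t \<in> p ` S) = p x" by (intro Least_equality) auto
  with x that show ?thesis by blast
qed

lemma continuous_on_Max:
  fixes p :: "'b \<Rightarrow> 'a::topological_space \<Rightarrow> real"
  assumes "finite I" "I \<noteq> {}" "\<And>i. i \<in> I \<Longrightarrow> continuous_on S (p i)"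
  shows "continuous_on S (\<lambda>x. Max ((\<lambda>i. p i x) ` I))"
  using assms
proof (induction rule: finite_ne_induct)
  case (insert i I)
  then have "(\<lambda>x. Max ((\<lambda>i. p i x) ` insert i I)) = (\<lambda>x. max (p i x) (Max ((\<lambda>i. p i x) ` I)))"
    by (intro ext) simp
  with insert show ?case by (auto intro!: continuous_on_max)
qed simp

section \<open>The numerical index\<close>

lemma numerical_radius_ge:
  fixes T :: "'a::real_normed_vector \<Rightarrow>\<^sub>L 'a"
  assumes "norm x = 1" "norm g = 1" "blinfun_apply g x = 1"
  shows "\<bar>blinfun_apply g (blinfun_apply T x)\<bar> \<le> numerical_radius T"
  unfolding numerical_radius_def
proof (rule cSup_upper)
  show "bdd_above {\<bar>blinfun_apply g (blinfun_apply T x)\<bar> | (x :: 'a) (g :: 'a \<Rightarrow>\<^sub>L real).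
            norm x = 1 \<and> norm g = 1 \<and> blinfun_apply g x = 1}"
  proof (rule bdd_aboveI[of _ "norm T"], clarify)
    fix x :: 'a and g :: "'a \<Rightarrow>\<^sub>L real" assume "norm x = 1" "norm g = 1"
    then show "\<bar>blinfun_apply g (blinfun_apply T x)\<bar> \<le> norm T"
      using norm_blinfun[of g "blinfun_apply T x"] norm_blinfun[of T x] by simp
  qed
qed (use assms in blast)

lemma operator_norm_attained_at_extreme_point:
  fixes E :: "'a::real_normed_vector set" and T :: "'a \<Rightarrow>\<^sub>L 'b::real_normed_vector"
  assumes "finite E" "independent E" "span E = UNIV"
  obtains x where "x \<in> unit_ball_vertices" "norm (blinfun_apply T x) = norm T"
proof -
  have "convex_on (cball 0 1) (\<lambda>x. norm (blinfun_apply T x))"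
    unfolding convex_on_def
  proof (intro conjI ballI allI impI)
    fix x y :: 'a and u w :: real assume "u \<ge> 0" "w \<ge> 0"
    then show "norm (blinfun_apply T (u *\<^sub>R x + w *\<^sub>R y))
        \<le> u * norm (blinfun_apply T x) + w * norm (blinfun_apply T y)"
      using norm_triangle_ineq[of "u *\<^sub>R blinfun_apply T x" "w *\<^sub>R blinfun_apply T y"]
      by (simp add: blinfun.bilinear_simps)
  qed simp
  moreover have "continuous_on (cball 0 1) (\<lambda>x. norm (blinfun_apply T x))"
    by (intro continuous_intros)
  ultimately obtain x where x: "x extreme_point_of cball 0 1"
    "\<And>y. y \<in> cball 0 1 \<Longrightarrow> norm (blinfun_apply T y) \<le> norm (blinfun_apply T x)"
    using bauer_maximum_principle[OF assms compact_cball_finite_span[OF assms, of 1],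
        of "\<lambda>x. norm (blinfun_apply T x)"] by auto
  have "norm T \<le> norm (blinfun_apply T x)"
  proof (rule norm_blinfun_bound)
    fix y
    show "norm (blinfun_apply T y) \<le> norm (blinfun_apply T x) * norm y"
    proof (cases "y = 0")
      case False
      then show ?thesis
        using x(2)[of "(1 / norm y) *\<^sub>R y"] by (simp add: blinfun.scaleR_right field_simps)
    qed simp
  qed simp
  moreover have "norm x \<le> 1" using x(1) by (simp add: extreme_point_of_def)
  then have "norm (blinfun_apply T x) \<le> norm T"
    using norm_blinfun[of T x] by (meson mult_left_le norm_ge_zero order_trans)
  ultimately show ?thesis
    using that[of x] x(1) by (simp add: unit_ball_vertices_def)
qed

theorem theorem2p2:
  fixes n m :: nat
    and v :: "nat \<Rightarrow> 'a::banach"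
    and F :: "nat \<Rightarrow> nat \<Rightarrow> 'a set"
    and f :: "nat \<Rightarrow> nat \<Rightarrow> 'a \<Rightarrow>\<^sub>L real"
    and \<kappa> :: "nat \<Rightarrow> real"
  assumes "polyhedral_space TYPE('a)"
    and "dim (UNIV :: 'a set) = n"
    and "n \<ge> 1"
    and "(unit_ball_vertices :: 'a set) = (\<Union>i\<in>{1..m}. {v i, - v i})"
    and "\<And>i. i \<in> {1..m} \<Longrightarrow> inj_on (F i) {1..n}"
    and "\<And>i r. i \<in> {1..m} \<Longrightarrow> r \<in> {1..n} \<Longrightarrow> unit_ball_facet (F i r)"
    and "\<And>i r. i \<in> {1..m} \<Longrightarrow> r \<in> {1..n} \<Longrightarrow> v i \<in> F i r"
    and "\<And>i r. i \<in> {1..m} \<Longrightarrow> r \<in> {1..n} \<Longrightarrow> supporting_functional (f i r) (F i r)"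
    and "\<And>i. i \<in> {1..m} \<Longrightarrow>
           \<kappa> i = (LEAST t. t \<in> (\<lambda>x. Max ((\<lambda>r. \<bar>blinfun_apply (f i r) x\<bar>) ` {1..n})) ` sphere 0 1)"
  shows "(\<forall>i\<in>{1..m}. n \<le> 3 \<or> independent (f i ` {1..n}) \<longrightarrow> \<kappa> i > 0) \<and>
         numerical_index TYPE('a) \<ge> Min (\<kappa> ` {1..m})"
proof -
  obtain E :: "'a set" where E: "finite E" "independent E" "span E = UNIV"
  proof -
    from assms(1) obtain B :: "'a set" where B: "finite B" "span B = UNIV"
      by (auto simp: polyhedral_space_def)
    obtain E :: "'a set" where E: "independent E" "UNIV \<subseteq> span E"
      using basis_exists[of "UNIV :: 'a set"] by metis
    have "finite E" using independent_span_bound[OF B(1) E(1)] B(2) by simp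
    then show ?thesis using that[of E] E by (simp add: top.extremum_unique)
  qed
  have n: "card E = n" using dim_eq_card[of E UNIV] E assms(2) by simp
  with \<open>n \<ge> 1\<close> obtain u :: 'a where "u \<in> E" by fastforce
  then have u0: "u \<noteq> 0" using E(2) dependent_zero by blast
  have sphere: "sphere (0::'a) 1 \<noteq> {}"
  proof -
    have "(1 / norm u) *\<^sub>R u \<in> sphere 0 1" using u0 by simp
    then show ?thesis by blast
  qed
  have compact_sphere: "compact (sphere (0::'a) 1)"
  proof -
    have "closed {x::'a. norm x = 1}"
      by (intro closed_Collect_eq continuous_intros)
    then have "compact (cball 0 1 \<inter> {x::'a. norm x = 1})"
      by (intro compact_Int_closed compact_cball_finite_span[OF E])
    moreover have "cball 0 1 \<inter> {x::'a. norm x = 1} = sphere 0 1" by auto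
    ultimately show ?thesis by simp
  qed
  let ?M = "\<lambda>i x. Max ((\<lambda>r. \<bar>blinfun_apply (f i r) x\<bar>) ` {1..n})"
  have kappa: "\<exists>x\<in>sphere 0 1. \<kappa> i = ?M i x \<and> (\<forall>y\<in>sphere 0 1. ?M i x \<le> ?M i y)" if i: "i \<in> {1..m}" for i
  proof -
    have "continuous_on (sphere 0 1) (?M i)"
      using \<open>n \<ge> 1\<close> by (intro continuous_on_Max continuous_intros) auto
    from Least_in_image_attained[OF compact_sphere sphere this] show ?thesis
      unfolding assms(9)[OF i] by metis
  qed
  note supp = supporting_functionalD[OF assms(8)]
  have fv: "blinfun_apply (f i r) (v i) = 1" "norm (v i) = 1" if "i \<in> {1..m}" "r \<in> {1..n}" for i r
    using assms(7)[OF that] supp(2)[OF that] by auto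
  have pos: "\<kappa> i > 0" if i: "i \<in> {1..m}" and "n \<le> 3 \<or> independent (f i ` {1..n})" for i
  proof -
    have "inj_on (f i) {1..n}"
    proof (rule inj_onI)
      fix r s assume rs: "r \<in> {1..n}" "s \<in> {1..n}" "f i r = f i s"
      then have "F i r = F i s" using supp(2)[OF i] by metis
      then show "r = s" using assms(5)[OF i] rs by (meson inj_onD)
    qed
    then have card: "card (f i ` {1..n}) = n" by (simp add: card_image)
    have "independent (f i ` {1..n})" if "n \<le> 3"
    proof (rule at_most_three_facet_functionals_independent[OF E])
      show "card (f i ` {1..n}) \<le> 3" using card that by simp
      show "\<exists>F. unit_ball_facet F \<and> supporting_functional g F \<and> v i \<in> F" if "g \<in> f i ` {1..n}" for g
        using that assms(6-8)[OF i] by blast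
    qed simp
    with that(2) have ind: "independent (f i ` {1..n})" by blast
    obtain x where x: "norm x = 1" "\<kappa> i = ?M i x" using kappa[OF i] by auto
    have "\<exists>r\<in>{1..n}. blinfun_apply (f i r) x \<noteq> 0"
    proof (rule ccontr)
      assume "\<not> ?thesis"
      then have "x = 0"
        using independent_functionals_separate[OF E ind] card n by auto
      with x show False by simp
    qed
    then show ?thesis unfolding x(2) using \<open>n \<ge> 1\<close> by (subst Max_gr_iff) auto
  qed
  have radius: "Min (\<kappa> ` {1..m}) \<le> numerical_radius T" if T: "norm T = 1" for T :: "'a \<Rightarrow>\<^sub>L 'a"
  proof -
    obtain x where x: "x \<in> unit_ball_vertices" "norm (blinfun_apply T x) = 1"
      using operator_norm_attained_at_extreme_point[OF E, of T] T by metis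
    from x(1) obtain i where i: "i \<in> {1..m}" and "x = v i \<or> x = - v i"
      unfolding assms(4) by blast
    with x(2) have Tv: "blinfun_apply T (v i) \<in> sphere 0 1"
      by (auto simp: blinfun.minus_right)
    have "Min (\<kappa> ` {1..m}) \<le> \<kappa> i" using i by simp
    also have "\<dots> \<le> ?M i (blinfun_apply T (v i))"
      using kappa[OF i] Tv by auto
    also have "\<dots> \<le> numerical_radius T"
    proof (rule Max.boundedI)
      fix a assume "a \<in> (\<lambda>r. \<bar>blinfun_apply (f i r) (blinfun_apply T (v i))\<bar>) ` {1..n}"
      then obtain r where r: "r \<in> {1..n}" "a = \<bar>blinfun_apply (f i r) (blinfun_apply T (v i))\<bar>" by blast
      show "a \<le> numerical_radius T"
        unfolding r(2) using fv[OF i r(1)] supp(1)[OF i r(1)] by (intro numerical_radius_ge)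
    qed (use \<open>n \<ge> 1\<close> in auto)
    finally show ?thesis .
  qed
  have "norm (id_blinfun :: 'a \<Rightarrow>\<^sub>L 'a) = 1"
  proof (rule antisym)
    show "norm (id_blinfun :: 'a \<Rightarrow>\<^sub>L 'a) \<le> 1" by (rule norm_blinfun_bound) auto
    show "1 \<le> norm (id_blinfun :: 'a \<Rightarrow>\<^sub>L 'a)"
      using norm_blinfun[of "id_blinfun :: 'a \<Rightarrow>\<^sub>L 'a" u] u0 by simp
  qed
  then have "Min (\<kappa> ` {1..m}) \<le> numerical_index TYPE('a)"
    unfolding numerical_index_def using radius by (intro cInf_greatest) auto
  with pos show ?thesis by blast
qed

end
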